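(* Let $0<\alpha<1$, $\gamma=\frac{2}{\alpha}-1$, $C>0$, and let $\phi(t)=B+\frac{A}{2\pi}\sin(2\pi t)$ with $A>0$ and $B>\frac{A}{2\pi}$. Let $F$ be the static wall approximation map $F(t,v)=\bigl(t+T(v),\,v+2\dot\phi(t+T(v))\bigr)$, $T(v)=C v^{\gamma}$, and let $$\mathscr{E}=\{(t_0,v_0)\ :\ v_n\to\infty \text{ as } n\to\infty\},\qquad (t_n,v_n)=F^n(t_0,v_0),$$ be the escaping set. Then the Hausdorff dimension of $\mathscr{E}$ equals $2$.
   Context: Static wall approximation to a particle bouncing on an oscillating plate in the potential $U(x)=x^\alpha$: the time $t$ is taken in $\mathbb{S}^1=\mathbb{R}/\mathbb{Z}$ and $v$ is the velocity after a collision. $F$ acts on points $(t,v)\in\mathbb{S}^1\times(0,\infty)$; $\dot\phi(t)=A\cos(2\pi t)$. A point $(t_0,v_0)$ belongs to $\mathscr{E}$ if its whole forward orbit $(t_n,v_n)=F^n(t_0,v_0)$, $n\ge 0$, is defined (i.e. $v_n>0$ for all $n$) and $v_n\to\infty$. *)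

theory Defs
  imports "HOL-Analysis.Analysis"
begin

section \<open>The circle \<open>\<real>/\<int>\<close>\<close>

quotient_type circle = real / "\<lambda>x y. x - y \<in> \<int>" morphisms rep_circle circle_of
proof (rule equivpI)
  show "reflp (\<lambda>x y::real. x - y \<in> \<int>)"
    by (simp add: reflp_def)
  show "symp (\<lambda>x y::real. x - y \<in> \<int>)"
  proof (rule sympI)
    fix x y :: real
    assume "x - y \<in> \<int>"
    then have "- (x - y) \<in> \<int>" by (rule Ints_minus)
    then show "y - x \<in> \<int>" by simp
  qed
  show "transp (\<lambda>x y::real. x - y \<in> \<int>)"
  proof (rule transpI)
    fix x y z :: real
    assume "x - y \<in> \<int>" "y - z \<in> \<int>"
    then have "(x - y) + (y - z) \<in> \<int>" by (rule Ints_add)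
    then show "x - z \<in> \<int>" by simp
  qed
qed

instantiation circle :: ab_group_add
begin

lift_definition zero_circle :: circle is 0 .

lift_definition plus_circle :: "circle \<Rightarrow> circle \<Rightarrow> circle" is "(+)"
proof -
  fix x x' y y' :: real
  assume "x - x' \<in> \<int>" "y - y' \<in> \<int>"
  then have "(x - x') + (y - y') \<in> \<int>" by (rule Ints_add)
  then show "(x + y) - (x' + y') \<in> \<int>" by (simp add: algebra_simps)
qed

lift_definition uminus_circle :: "circle \<Rightarrow> circle" is uminus
proof -
  fix x x' :: real
  assume "x - x' \<in> \<int>"
  then have "- (x - x') \<in> \<int>" by (rule Ints_minus)
  then show "- x - - x' \<in> \<int>" by simp
qed

lift_definition minus_circle :: "circle \<Rightarrow> circle \<Rightarrow> circle" is "(-)"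
proof -
  fix x x' y y' :: real
  assume "x - x' \<in> \<int>" "y - y' \<in> \<int>"
  then have "(x - x') - (y - y') \<in> \<int>" by (rule Ints_diff)
  then show "(x - y) - (x' - y') \<in> \<int>" by (simp add: algebra_simps)
qed

instance
  by standard (transfer; simp)+

end

lemma infdist_Ints_add:
  fixes x k :: real
  assumes "k \<in> \<int>"
  shows "infdist (x + k) \<int> = infdist x \<int>"
proof -
  have le: "infdist (y + l) \<int> \<le> infdist y \<int>" if l: "l \<in> \<int>" for y l :: real
  proof -
    obtain m where m: "m \<in> \<int>" "infdist y \<int> = dist y m"
      using infdist_attains_inf[of "\<int> :: real set" y] closed_Ints Ints_0 by blast
    have "infdist (y + l) \<int> \<le> dist (y + l) (m + l)"
      using m(1) l by (intro infdist_le Ints_add)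
    then show ?thesis using m(2) by (simp add: dist_real_def)
  qed
  show ?thesis
    using le[of k x] le[of "- k" "x + k"] assms by (simp add: antisym)
qed

lemma infdist_Ints_uminus:
  fixes x :: real
  shows "infdist (- x) \<int> = infdist x \<int>"
proof -
  have le: "infdist (- y) \<int> \<le> infdist y \<int>" for y :: real
  proof -
    obtain m where m: "m \<in> \<int>" "infdist y \<int> = dist y m"
      using infdist_attains_inf[of "\<int> :: real set" y] closed_Ints Ints_0 by blast
    have "infdist (- y) \<int> \<le> dist (- y) (- m)"
      using m(1) by (intro infdist_le) simp
    then show ?thesis using m(2) by (simp add: dist_real_def)
  qed
  show ?thesis using le[of x] le[of "- x"] by simp
qed

lemma infdist_Ints_triangle:
  fixes x y :: real
  shows "infdist (x + y) \<int> \<le> infdist x \<int> + infdist y \<int>"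
proof -
  obtain m where m: "m \<in> \<int>" "infdist y \<int> = dist y m"
    using infdist_attains_inf[of "\<int> :: real set" y] closed_Ints Ints_0 by blast
  have "infdist (x + y) \<int> \<le> infdist (x + m) \<int> + dist (x + y) (x + m)"
    by (rule infdist_triangle)
  then show ?thesis using m infdist_Ints_add[OF m(1), of x] by (simp add: dist_real_def)
qed

instantiation circle :: metric_space
begin

lift_definition dist_circle :: "circle \<Rightarrow> circle \<Rightarrow> real" is "\<lambda>x y. infdist (x - y) \<int>"
proof -
  fix x x' y y' :: real
  assume "x - x' \<in> \<int>" "y - y' \<in> \<int>"
  then have "(x - x') - (y - y') \<in> \<int>" by (rule Ints_diff)
  from infdist_Ints_add[OF this, of "x' - y'"]
  show "infdist (x - y) \<int> = infdist (x' - y') \<int>" by simp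
qed

definition uniformity_circle :: "(circle \<times> circle) filter" where
  "uniformity_circle = (INF e\<in>{0 <..}. principal {(x, y). dist x y < e})"

definition open_circle :: "circle set \<Rightarrow> bool" where
  "open_circle U = (\<forall>x\<in>U. eventually (\<lambda>(x', y). x' = x \<longrightarrow> y \<in> U) uniformity)"

instance
proof
  fix x y z :: circle
  show "dist x y = 0 \<longleftrightarrow> x = y"
  proof transfer
    fix x y :: real
    show "infdist (x - y) \<int> = 0 \<longleftrightarrow> x - y \<in> \<int>"
      using in_closed_iff_infdist_zero[of "\<int> :: real set" "x - y"] closed_Ints Ints_0
      by blast
  qed
  show "dist x y \<le> dist x z + dist y z"
  proof transfer
    fix x y z :: real
    show "infdist (x - y) \<int> \<le> infdist (x - z) \<int> + infdist (y - z) \<int>"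
      using infdist_Ints_triangle[of "x - z" "z - y"] infdist_Ints_uminus[of "y - z"] by simp
  qed
qed (simp_all add: uniformity_circle_def open_circle_def)

end

text \<open>
  Evaluation of a function on \<open>\<real>\<close> at a point of the circle; only meaningful for functions of
  period 1.
\<close>

definition on_circle :: "(real \<Rightarrow> 'a) \<Rightarrow> circle \<Rightarrow> 'a" where
  "on_circle g t = g (rep_circle t)"

lemma on_circle_circle_of:
  assumes "\<And>x. g (x + 1) = g x"
  shows "on_circle g (circle_of x) = g x"
proof -
  have nat: "g (y + of_nat n) = g y" for y n
  proof (induction n)
    case (Suc n)
    have "g (y + of_nat (Suc n)) = g ((y + of_nat n) + 1)" by (simp add: ac_simps)
    then show ?case using assms Suc by simp
  qed simp
  have int: "g (y + of_int k) = g y" for y k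
  proof (cases "k \<ge> 0")
    case True
    then show ?thesis using nat[of y "nat k"] by simp
  next
    case False
    then show ?thesis using nat[of "y + of_int k" "nat (- k)"] by simp
  qed
  have "rep_circle (circle_of x) - x \<in> \<int>"
    using Quotient_circle Quotient_rep_abs by fastforce
  then obtain k where "rep_circle (circle_of x) - x = of_int k" by (rule Ints_cases)
  then have "rep_circle (circle_of x) = x + of_int k" by simp
  then show ?thesis unfolding on_circle_def by (simp only: int)
qed


section \<open>Hausdorff dimension\<close>

text \<open>
  The contribution \<open>(diam U)\<^sup>s\<close> of a bounded set to a covering sum, with the usual conventions
  for \<open>s = 0\<close>; note \<open>0 powr 0 = 0\<close>.
\<close>

definition diam_powr :: "real \<Rightarrow> 'a::metric_space set \<Rightarrow> ennreal" where
  "diam_powr s U = (if U = {} then 0 else if s = 0 then 1 else ennreal (diameter U powr s))"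

text \<open>
  Boundedness of the covering sets is required separately because \<^const>\<open>diameter\<close> has no
  meaningful value on unbounded sets.
\<close>

definition hausdorff_premeasure :: "real \<Rightarrow> real \<Rightarrow> 'a::metric_space set \<Rightarrow> ennreal" where
  "hausdorff_premeasure s \<delta> S =
     Inf {\<Sum>i. diam_powr s (U i) | U :: nat \<Rightarrow> 'a set.
            S \<subseteq> (\<Union>i. U i) \<and> (\<forall>i. bounded (U i) \<and> diameter (U i) \<le> \<delta>)}"

definition hausdorff_measure :: "real \<Rightarrow> 'a::metric_space set \<Rightarrow> ennreal" where
  "hausdorff_measure s S = (SUP \<delta>\<in>{0<..}. hausdorff_premeasure s \<delta> S)"

definition hausdorff_dim :: "'a::metric_space set \<Rightarrow> ennreal" where
  "hausdorff_dim S = Inf {ennreal s | s. 0 \<le> s \<and> hausdorff_measure s S = 0}"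


section \<open>The static wall approximation\<close>

definition static_wall_map ::
  "(real \<Rightarrow> real) \<Rightarrow> (real \<Rightarrow> real) \<Rightarrow> circle \<times> real \<Rightarrow> circle \<times> real" where
  "static_wall_map T \<phi> = (\<lambda>(t, v).
     (t + circle_of (T v), v + 2 * on_circle (deriv \<phi>) (t + circle_of (T v))))"

text \<open>
  The map lives on velocities \<open>v > 0\<close>. It is represented by a total function, and positivity of
  all velocities along the orbit expresses that the whole forward orbit is defined.
\<close>

definition escaping_set :: "(circle \<times> real \<Rightarrow> circle \<times> real) \<Rightarrow> (circle \<times> real) set" where
  "escaping_set F =
     {p. (\<forall>n. snd ((F ^^ n) p) > 0) \<and> filterlim (\<lambda>n. snd ((F ^^ n) p)) at_top sequentially}"

lemma deriv_wall:
  fixes A B :: real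
  shows "deriv (\<lambda>t. B + A / (2 * pi) * sin (2 * pi * t)) = (\<lambda>t. A * cos (2 * pi * t))"
proof
  fix t :: real
  show "deriv (\<lambda>t. B + A / (2 * pi) * sin (2 * pi * t)) t = A * cos (2 * pi * t)"
    by (rule DERIV_imp_deriv) (auto intro!: derivative_eq_intros)
qed

lemma on_circle_deriv_wall:
  fixes A B x :: real
  shows "on_circle (deriv (\<lambda>t. B + A / (2 * pi) * sin (2 * pi * t))) (circle_of x) =
    A * cos (2 * pi * x)"
  unfolding deriv_wall
  by (rule on_circle_circle_of) (simp add: distrib_left)

end

(*
  In the (t, v) plane the image of a graph whose slope is bounded away from 0 and infinity, over an
  arc where the cosine and its slope are both positive, is again such a graph, stretched in the time
  direction by a factor of order v^(gamma - 1). It therefore contains of the order of v^(gamma - 1)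
  full copies of graphs of the same kind, with velocity raised by at least A. Since the factor tends to
  infinity with v, while only a fixed proportion of the graph is lost in each step, the set of escaping
  times at a fixed large initial velocity has dimension 1. This is shown without a measure: if a family
  of sets has small s-dimensional content, the pigeonhole principle gives a nested sequence of arcs that
  the family hits less and less, and their common point escapes and is not covered. The bound is uniform
  in the initial velocity, and integration over that velocity adds 1 to the dimension.
*)

theory Submission
  imports Defs
begin

section \<open>Covering sums on an arc and the pigeonhole principle\<close>

text \<open>In the applications \<open>d i\<close> is a positive upper bound for the diameter of
  \<open>U i\<close>, so this is an s-dimensional covering sum restricted to the members that meet
  \<open>J\<close>. With \<open>d i > 0\<close> even a one-point set has a positive cost.\<close>

definition hitting_mass :: "real \<Rightarrow> (nat \<Rightarrow> real set) \<Rightarrow> (nat \<Rightarrow> real) \<Rightarrow> real set \<Rightarrow> ennreal" where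
  "hitting_mass s U d J = (\<Sum>i. if U i \<inter> J = {} then 0 else ennreal (d i powr s))"

lemma hitting_mass_mem:
  assumes "x \<in> U i" "x \<in> J"
  shows "ennreal (d i powr s) \<le> hitting_mass s U d J"
proof -
  have "ennreal (d i powr s) = (if U i \<inter> J = {} then 0 else ennreal (d i powr s))"
    using assms by auto
  also have "\<dots> \<le> hitting_mass s U d J"
    unfolding hitting_mass_def
    using sum_le_suminf[of "\<lambda>i. if U i \<inter> J = {} then 0 else ennreal (d i powr s)" "{i}"] by simp
  finally show ?thesis .
qed

text \<open>Since no \<open>U i\<close> meets two of the sets \<open>J' k\<close>, their masses add
  up to at most that of \<open>J\<close>, and the smallest of them is at most the average.\<close>

lemma hitting_mass_pigeonhole:
  assumes fin: "finite K" and ne: "K \<noteq> {}"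
    and sub: "\<And>k. k \<in> K \<Longrightarrow> J' k \<subseteq> J"
    and one: "\<And>i k l. k \<in> K \<Longrightarrow> l \<in> K \<Longrightarrow> U i \<inter> J' k \<noteq> {} \<Longrightarrow> U i \<inter> J' l \<noteq> {} \<Longrightarrow> k = l"
    and m: "hitting_mass s U d J \<le> ennreal \<beta>" "0 \<le> \<beta>"
  shows "\<exists>k\<in>K. hitting_mass s U d (J' k) \<le> ennreal (\<beta> / card K)"
proof -
  define f where "f i k = (if U i \<inter> J' k = {} then 0 else ennreal (d i powr s))" for i k
  have fK: "(\<Sum>k\<in>K. f i k) \<le> (if U i \<inter> J = {} then 0 else ennreal (d i powr s))" for i
  proof (cases "\<exists>k\<in>K. U i \<inter> J' k \<noteq> {}")
    case True
    then obtain k where k: "k \<in> K" "U i \<inter> J' k \<noteq> {}" by blast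
    have "(\<Sum>l\<in>K. f i l) = (\<Sum>l\<in>K. if l = k then ennreal (d i powr s) else 0)"
      using one k by (intro sum.cong refl) (auto simp: f_def)
    also have "\<dots> = ennreal (d i powr s)" using fin k by simp
    finally show ?thesis using k sub by auto
  next
    case False
    then show ?thesis by (simp add: f_def)
  qed
  define m where "m k = hitting_mass s U d (J' k)" for k
  have "Min (m ` K) \<in> m ` K" using fin ne by (intro Min_in) auto
  then obtain k where k: "k \<in> K" "Min (m ` K) = m k" by blast
  have "of_nat (card K) * m k \<le> (\<Sum>l\<in>K. m l)"
    using fin k by (intro sum_bounded_below) (metis Min_le finite_imageI imageI)
  also have "\<dots> = (\<Sum>i. \<Sum>k\<in>K. f i k)"
    unfolding m_def hitting_mass_def f_def by (rule suminf_sum[symmetric]) auto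
  also have "\<dots> \<le> hitting_mass s U d J"
    unfolding hitting_mass_def by (intro suminf_le fK) auto
  also note m(1)
  finally have le: "of_nat (card K) * m k \<le> ennreal \<beta>" .
  have card: "0 < card K" using fin ne by (simp add: card_gt_0_iff)
  have "m k \<le> ennreal (\<beta> / card K)"
  proof (cases "m k")
    case (real r)
    then have "card K * r \<le> \<beta>"
      using le m(2) by (simp add: ennreal_of_nat_eq_real_of_nat flip: ennreal_mult)
    then show ?thesis using card real m(2) by (simp add: field_simps ennreal_le_iff)
  next
    case top
    then show ?thesis using le card by (simp add: ennreal_mult_top top_unique)
  qed
  then show ?thesis using k(1) unfolding m_def by blast
qed

section \<open>Mean value estimates for the cosine and for powers\<close>

text \<open>For \<open>z\<close> in the arc, \<open>2 * pi * (j - z)\<close> lies between pi/6 and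
  pi/3, so \<open>- sin (2 * pi * z)\<close> lies in [1/2, 1] and the derivative of the cosine in
  [pi, 2 pi].\<close>

lemma cos_diff_bounds:
  fixes x y :: real
  assumes "j \<in> \<int>" "x < y" "j - 1/6 \<le> x" "y \<le> j - 1/12"
  shows "pi * (y - x) \<le> cos (2 * pi * y) - cos (2 * pi * x)"
    and "cos (2 * pi * y) - cos (2 * pi * x) \<le> 2 * pi * (y - x)"
proof -
  have "\<exists>z. z > x \<and> z < y \<and> cos (2 * pi * y) - cos (2 * pi * x) = (y - x) * (- sin (2 * pi * z) * (2 * pi))"
    by (intro MVT2 assms) (auto intro!: derivative_eq_intros)
  then obtain z where z: "x < z" "z < y"
    "cos (2 * pi * y) - cos (2 * pi * x) = (y - x) * (- sin (2 * pi * z) * (2 * pi))"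
    by blast
  have "sin (2 * pi * (j - z)) = - sin (2 * pi * z)"
  proof -
    obtain n where "j = of_int n" using assms(1) by (rule Ints_cases)
    then have "sin (2 * pi * (j - z)) = sin (- (2 * pi * z) + 2 * pi * of_int n)"
      by (simp add: algebra_simps)
    also have "\<dots> = - sin (2 * pi * z)"
      by (simp add: sin_diff sin_add sin_int_2pin cos_int_2pin)
    finally show ?thesis .
  qed
  \<comment> \<open>The sine increases up to pi/2. The second case is vacuous, because the argument
    is at most pi/3.\<close>
  moreover have "sin (pi / 6) \<le> sin (2 * pi * (j - z))"
  proof (cases "2 * pi * (j - z) \<le> pi / 2")
    case True
    have "2 * pi * (1 / 12) \<le> 2 * pi * (j - z)" using z assms by (intro mult_left_mono) auto
    then show ?thesis using True pi_gt_zero by (intro sin_monotone_2pi_le) auto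
  next
    case False
    have "2 * pi * (j - z) \<le> 2 * pi * (1 / 6)" using z assms by (intro mult_left_mono) auto
    then show ?thesis using False pi_gt_zero by linarith
  qed
  ultimately have s: "1 / 2 \<le> - sin (2 * pi * z)" "- sin (2 * pi * z) \<le> 1"
    using sin_ge_minus_one[of "2 * pi * z"] by (auto simp: sin_30)
  have "(y - x) * (1 / 2 * (2 * pi)) \<le> (y - x) * (- sin (2 * pi * z) * (2 * pi))"
    using s assms by (intro mult_left_mono mult_right_mono) auto
  then show "pi * (y - x) \<le> cos (2 * pi * y) - cos (2 * pi * x)"
    unfolding z(3) by (simp add: mult.commute)
  have "(y - x) * (- sin (2 * pi * z) * (2 * pi)) \<le> (y - x) * (1 * (2 * pi))"
    using s assms by (intro mult_left_mono mult_right_mono) auto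
  then show "cos (2 * pi * y) - cos (2 * pi * x) \<le> 2 * pi * (y - x)"
    by (simp only: z(3) mult_1_left mult.commute[of "y - x" "2 * pi"])
qed

text \<open>The cosine is smallest on the arc at its left end, so the kick
  \<open>2 * A * cos\<close> there, equal to \<open>A\<close>, is the least velocity gain on the
  arc.\<close>

lemma cos_left_endpoint:
  fixes j :: real
  assumes "j \<in> \<int>"
  shows "cos (2 * pi * (j - 1/6)) = 1 / 2"
proof -
  obtain n where "j = of_int n" using assms by (rule Ints_cases)
  then have "cos (2 * pi * (j - 1/6)) = cos (2 * pi * of_int n - pi / 3)"
    by (simp add: algebra_simps)
  also have "\<dots> = 1 / 2" by (simp add: cos_diff sin_int_2pin cos_int_2pin cos_60)
  finally show ?thesis .
qed

lemma powr_diff_bounds: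
  fixes u v W :: real
  assumes "0 < V" "V \<le> u" "u < v" "v \<le> W" "1 < g"
  shows "g * V powr (g - 1) * (v - u) \<le> v powr g - u powr g"
    and "v powr g - u powr g \<le> g * W powr (g - 1) * (v - u)"
proof -
  have "\<exists>z. z > u \<and> z < v \<and> v powr g - u powr g = (v - u) * (g * z powr (g - 1))"
    using assms by (intro MVT2) (auto intro!: derivative_eq_intros)
  then obtain z where z: "u < z" "z < v" "v powr g - u powr g = (v - u) * (g * z powr (g - 1))"
    by blast
  have "V powr (g - 1) \<le> z powr (g - 1)" "z powr (g - 1) \<le> W powr (g - 1)"
    using assms z by (auto intro!: powr_mono2)
  then have "(v - u) * (g * V powr (g - 1)) \<le> (v - u) * (g * z powr (g - 1))"
    "(v - u) * (g * z powr (g - 1)) \<le> (v - u) * (g * W powr (g - 1))"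
    using assms by (auto intro!: mult_left_mono)
  then show "g * V powr (g - 1) * (v - u) \<le> v powr g - u powr g"
    "v powr g - u powr g \<le> g * W powr (g - 1) * (v - u)"
    unfolding z(3) by (simp_all add: mult_ac)
qed

lemma card_ceiling_floor:
  fixes x y :: real
  shows "y - x - 1 \<le> card {\<lceil>x\<rceil>..\<lfloor>y\<rfloor>}"
proof -
  have "y - x - 1 \<le> real_of_int (\<lfloor>y\<rfloor> - \<lceil>x\<rceil> + 1)" by linarith
  also have "\<dots> \<le> card {\<lceil>x\<rceil>..\<lfloor>y\<rfloor>}" by simp
  finally show ?thesis .
qed

section \<open>Steep curves and their expansion\<close>

text \<open>With \<open>1 < \<gamma>\<close> the derivative of the flight time
  \<open>C * v powr \<gamma>\<close> tends to infinity with \<open>v\<close>; this is the source of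
  all expansion below.\<close>

locale wall =
  fixes A C \<gamma> :: real
  assumes A: "0 < A" and C: "0 < C" and \<gamma>: "1 < \<gamma>"
begin

text \<open>On the arc the kick \<open>2 * A * cos\<close>, as a function of the arrival time, has
  slope between 2 pi A and 4 pi A. The extra 1 in \<open>slope_hi\<close> absorbs what remains of
  the slope that the curve had before the step.\<close>

definition slope_lo :: real where "slope_lo = 2 * pi * A"
definition slope_hi :: real where "slope_hi = 4 * pi * A + 1"
text \<open>\<open>expand_lo V\<close> and \<open>expand_hi V\<close> bound d\<theta>'/d\<theta> = 1
  + T'(v) dv/d\<theta> on a steep curve whose lowest velocity is \<open>V\<close>; its velocities
  reach at most \<open>V + slope_hi\<close>.\<close>

definition expand_lo :: "real \<Rightarrow> real" where
  "expand_lo V = 1 + C * (\<gamma> * V powr (\<gamma> - 1)) * slope_lo"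
definition expand_hi :: "real \<Rightarrow> real" where
  "expand_hi V = 1 + C * (\<gamma> * (V + slope_hi) powr (\<gamma> - 1)) * slope_hi"

lemma slope_pos: "0 < slope_lo" "0 < slope_hi" "1 \<le> slope_hi"
  using A by (auto simp: slope_lo_def slope_hi_def intro: add_pos_pos)

lemma expand_hi_ge_1: "1 \<le> expand_hi V"
  using slope_pos C \<gamma> by (simp add: expand_hi_def)

lemma expand_hi_mono: "0 \<le> V \<Longrightarrow> V \<le> W \<Longrightarrow> expand_hi V \<le> expand_hi W"
  using slope_pos C \<gamma> unfolding expand_hi_def
  by (intro add_mono mult_mono powr_mono2) auto

text \<open>The bound 48 leaves room for at least \<open>expand_lo V / 24\<close> full copies of the
  arc in the image of a curve. The second condition flattens the inherited slope to at most 1. The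
  third makes the number of copies at least \<open>expand_hi\<close> to the power \<open>s\<close>
  at every velocity at which the next curve can begin.\<close>

definition large :: "real \<Rightarrow> real \<Rightarrow> bool" where
  "large s V0 \<longleftrightarrow> 0 < V0 \<and> (\<forall>V\<ge>V0. 48 \<le> expand_lo V \<and> slope_hi \<le> expand_lo V \<and>
     24 * expand_hi (V + slope_hi + A) powr s \<le> expand_lo V)"

text \<open>
  A curve \<open>x \<mapsto> (\<theta> x, v x)\<close> that lifts to a monotone graph over a translate of
  \<open>[- 1/6, - 1/12]\<close>, an arc on which both the cosine and the slope of the cosine are positive.
\<close>

definition steep_curve ::
    "(real \<Rightarrow> real) \<Rightarrow> (real \<Rightarrow> real) \<Rightarrow> real \<Rightarrow> real \<Rightarrow> real \<Rightarrow> bool" where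
  "steep_curve \<theta> v a b w \<longleftrightarrow> a < b \<and> 0 < w \<and>
     (\<exists>k\<in>\<int>. \<theta> a = k - 1/6 \<and> \<theta> b = k - 1/12) \<and>
     (\<forall>x y. a \<le> x \<longrightarrow> x < y \<longrightarrow> y \<le> b \<longrightarrow>
        0 < \<theta> y - \<theta> x \<and> \<theta> y - \<theta> x \<le> w * (y - x) \<and>
        slope_lo * (\<theta> y - \<theta> x) \<le> v y - v x \<and> v y - v x \<le> slope_hi * (\<theta> y - \<theta> x))"

lemma steep_curveD:
  assumes "steep_curve \<theta> v a b w" "a \<le> x" "x < y" "y \<le> b"
  shows "0 < \<theta> y - \<theta> x" "\<theta> y - \<theta> x \<le> w * (y - x)"
    "slope_lo * (\<theta> y - \<theta> x) \<le> v y - v x" "v y - v x \<le> slope_hi * (\<theta> y - \<theta> x)" "v x < v y"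
proof -
  show *: "0 < \<theta> y - \<theta> x" "\<theta> y - \<theta> x \<le> w * (y - x)"
    "slope_lo * (\<theta> y - \<theta> x) \<le> v y - v x" "v y - v x \<le> slope_hi * (\<theta> y - \<theta> x)"
    using assms unfolding steep_curve_def by blast+
  show "v x < v y" using mult_pos_pos[OF slope_pos(1) *(1)] *(3) by linarith
qed

lemma steep_curve_min: "steep_curve \<theta> v a b w \<Longrightarrow> a \<le> x \<Longrightarrow> x \<le> b \<Longrightarrow> v a \<le> v x"
  using steep_curveD(5)[of \<theta> v a b w a x] by (cases "a = x") auto

text \<open>The times on the curve span 1/12, so its velocities spread by at most
  \<open>slope_hi / 12\<close>, generously rounded up.\<close>

lemma steep_curve_max:
  assumes "steep_curve \<theta> v a b w" "a \<le> x" "x \<le> b"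
  shows "v x \<le> v a + slope_hi"
proof -
  have ab: "a < b" "\<theta> b - \<theta> a = 1 / 12" using assms(1) unfolding steep_curve_def by auto
  have "v x \<le> v b" using steep_curveD(5)[OF assms(1), of x b] assms by (cases "x = b") auto
  also have "v b - v a \<le> slope_hi * (1 / 12)"
    using steep_curveD(4)[OF assms(1), of a b] ab by simp
  then have "v b \<le> v a + slope_hi" using slope_pos by simp
  finally show ?thesis .
qed

text \<open>The mean value theorem for \<open>v powr \<gamma>\<close> turns the slope bounds of the
  curve into bounds for the stretching of time. Here \<open>w\<close> is a Lipschitz constant of
  \<theta> in the parameter, and the third bound provides the one for \<theta>'.\<close>

lemma expansion:
  assumes st: "steep_curve \<theta> v a b w" and pos: "0 < v a" and xy: "a \<le> x" "x < y" "y \<le> b"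
    and \<theta>': "\<theta>' = (\<lambda>x. \<theta> x + C * v x powr \<gamma>)"
  shows "expand_lo (v a) * (\<theta> y - \<theta> x) \<le> \<theta>' y - \<theta>' x"
    and "\<theta>' y - \<theta>' x \<le> expand_hi (v a) * (\<theta> y - \<theta> x)"
    and "\<theta>' y - \<theta>' x \<le> w * expand_hi (v a) * (y - x)"
proof -
  define q where "q = \<theta> y - \<theta> x"
  note D = steep_curveD[OF st xy, folded q_def]
  have p: "v a \<le> v x" "v y \<le> v a + slope_hi"
    using steep_curve_min[OF st, of x] steep_curve_max[OF st, of y] xy by auto
  note B = powr_diff_bounds[OF pos p(1) D(5) p(2) \<gamma>]
  have "C * (\<gamma> * v a powr (\<gamma> - 1)) * (slope_lo * q) \<le> C * (\<gamma> * v a powr (\<gamma> - 1)) * (v y - v x)"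
    using D C \<gamma> by (intro mult_left_mono) auto
  also have "\<dots> \<le> C * (v y powr \<gamma> - v x powr \<gamma>)"
    using mult_left_mono[OF B(1), of C] C by (simp add: mult.assoc)
  finally show "expand_lo (v a) * (\<theta> y - \<theta> x) \<le> \<theta>' y - \<theta>' x"
    unfolding expand_lo_def \<theta>' by (simp add: q_def algebra_simps)
  have "C * (v y powr \<gamma> - v x powr \<gamma>) \<le> C * (\<gamma> * (v a + slope_hi) powr (\<gamma> - 1)) * (v y - v x)"
    using mult_left_mono[OF B(2), of C] C by (simp add: mult.assoc)
  also have "\<dots> \<le> C * (\<gamma> * (v a + slope_hi) powr (\<gamma> - 1)) * (slope_hi * q)"
    using D C \<gamma> by (intro mult_left_mono) auto
  finally show *: "\<theta>' y - \<theta>' x \<le> expand_hi (v a) * (\<theta> y - \<theta> x)"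
    unfolding expand_hi_def \<theta>' by (simp add: q_def algebra_simps)
  also have "\<dots> \<le> expand_hi (v a) * (w * (y - x))"
    using D(2) expand_hi_ge_1[of "v a"] by (intro mult_left_mono) (auto simp: q_def)
  finally show "\<theta>' y - \<theta>' x \<le> w * expand_hi (v a) * (y - x)" by (simp add: mult_ac)
qed

text \<open>The child is the piece of the curve that \<theta>' maps onto [j - 1/6, j - 1/12], cut
  out by the intermediate value theorem. Its slope is that of the new kick plus the inherited slope,
  measured in stretched time.\<close>

lemma steep_curve_child:
  assumes st: "steep_curve \<theta> v a b w" and V: "0 < v a" "slope_hi \<le> expand_lo (v a)"
    and \<theta>': "\<theta>' = (\<lambda>x. \<theta> x + C * v x powr \<gamma>)"
    and v': "v' = (\<lambda>x. v x + 2 * (A * cos (2 * pi * \<theta>' x)))"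
    and j: "j \<in> \<int>" "\<theta>' a \<le> j - 1/6" "j - 1/12 \<le> \<theta>' b"
  shows "\<exists>c e. a \<le> c \<and> e \<le> b \<and> steep_curve \<theta>' v' c e (w * expand_hi (v a)) \<and>
    (\<forall>x\<in>{c..e}. j - 1/6 \<le> \<theta>' x \<and> \<theta>' x \<le> j - 1/12) \<and> v' c = v c + A"
proof -
  note ex = expansion[OF st V(1) _ _ _ \<theta>']
  have ab: "a < b" "0 < w" using st unfolding steep_curve_def by auto
  have mono: "\<theta>' x < \<theta>' y" if "a \<le> x" "x < y" "y \<le> b" for x y
  proof -
    have "0 < expand_lo (v a) * (\<theta> y - \<theta> x)"
      using steep_curveD(1)[OF st that] V slope_pos by (intro mult_pos_pos) auto
    then show ?thesis using ex(1)[OF that] by linarith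
  qed
  \<comment> \<open>For \<theta> and \<open>v\<close> only increment bounds are given, so continuity
    is drawn from the Lipschitz estimate.\<close>
  have cont: "continuous_on {a..b} \<theta>'"
  proof (rule lipschitz_on_continuous_on)
    show "(w * expand_hi (v a))-lipschitz_on {a..b} \<theta>'"
    proof (rule lipschitz_onI)
      show "0 \<le> w * expand_hi (v a)" using ab expand_hi_ge_1[of "v a"] by simp
      show "dist (\<theta>' x) (\<theta>' y) \<le> w * expand_hi (v a) * dist x y" if "x \<in> {a..b}" "y \<in> {a..b}" for x y
      proof (cases x y rule: linorder_cases)
        case less
        then show ?thesis using ex(3)[of x y] mono[of x y] that by (simp add: dist_real_def)
      next
        case greater
        then show ?thesis using ex(3)[of y x] mono[of y x] that by (simp add: dist_real_def)
      qed simp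
    qed
  qed
  obtain c where c: "a \<le> c" "c \<le> b" "\<theta>' c = j - 1/6"
    using IVT'[of \<theta>' a "j - 1/6" b] j ab cont by auto
  obtain e where e: "a \<le> e" "e \<le> b" "\<theta>' e = j - 1/12"
    using IVT'[of \<theta>' a "j - 1/12" b] j ab cont by auto
  have ce: "c < e" using mono[of e c] c e by (cases c e rule: linorder_cases) auto
  have range: "j - 1/6 \<le> \<theta>' x \<and> \<theta>' x \<le> j - 1/12" if "x \<in> {c..e}" for x
    using mono[of c x] mono[of x e] that c e by (cases "x = c"; cases "x = e") auto
  have "steep_curve \<theta>' v' c e (w * expand_hi (v a))"
    unfolding steep_curve_def
  proof (intro conjI allI impI)
    show "c < e" "0 < w * expand_hi (v a)" using ce ab expand_hi_ge_1[of "v a"] by simp_all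
    show "\<exists>k\<in>\<int>. \<theta>' c = k - 1/6 \<and> \<theta>' e = k - 1/12" using c e j by blast
    fix x y assume xy: "c \<le> x" "x < y" "y \<le> e"
    have xy': "a \<le> x" "y \<le> b" using xy c e by auto
    show "0 < \<theta>' y - \<theta>' x" using mono[of x y] xy xy' by simp
    show "\<theta>' y - \<theta>' x \<le> w * expand_hi (v a) * (y - x)" using ex(3) xy xy' by simp
    define q where "q = \<theta>' y - \<theta>' x"
    note cs = cos_diff_bounds[OF j(1), of "\<theta>' x" "\<theta>' y", folded q_def]
    have cs1: "2 * A * (pi * q) \<le> 2 * A * (cos (2 * pi * \<theta>' y) - cos (2 * pi * \<theta>' x))"
      using cs(1) range[of x] range[of y] mono[of x y] xy xy' A by (intro mult_left_mono) auto
    have cs2: "2 * A * (cos (2 * pi * \<theta>' y) - cos (2 * pi * \<theta>' x)) \<le> 2 * A * (2 * pi * q)"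
      using cs(2) range[of x] range[of y] mono[of x y] xy xy' A by (intro mult_left_mono) auto
    have dv: "v' y - v' x = (v y - v x) + 2 * A * (cos (2 * pi * \<theta>' y) - cos (2 * pi * \<theta>' x))"
      by (simp add: v' algebra_simps)
    show "slope_lo * (\<theta>' y - \<theta>' x) \<le> v' y - v' x"
      using cs1 steep_curveD(5)[OF st xy'(1) xy(2) xy'(2)] unfolding dv slope_lo_def
      by (simp add: q_def mult_ac)
    \<comment> \<open>Per unit of \<theta>' the inherited slope is at most
      \<open>slope_hi / expand_lo (v a)\<close>, hence at most 1.\<close>
    have "v y - v x \<le> slope_hi * (\<theta> y - \<theta> x)"
      using steep_curveD(4)[OF st xy'(1) xy(2) xy'(2)] .
    also have "\<dots> \<le> expand_lo (v a) * (\<theta> y - \<theta> x)"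
      using V steep_curveD(1)[OF st xy'(1) xy(2) xy'(2)] by (intro mult_right_mono) auto
    also have "\<dots> \<le> q" using ex(1)[OF xy'(1) xy(2) xy'(2)] by (simp add: q_def)
    finally show "v' y - v' x \<le> slope_hi * (\<theta>' y - \<theta>' x)"
      using cs2 unfolding dv slope_hi_def by (simp add: q_def[symmetric] algebra_simps)
  qed
  moreover have "v' c = v c + A" using cos_left_endpoint[OF j(1)] c(3) by (simp add: v')
  ultimately show ?thesis using c e range by blast
qed

text \<open>The mass bound does two things. It makes every \<open>U i\<close> that meets the arc too
  small to meet two children, so the pigeonhole principle applies. It also reproduces itself: the
  gain \<open>card K\<close> from the pigeonhole pays for the factor
  \<open>expand_hi (v' c) powr s\<close> in the bound for the child.\<close>

lemma steep_curve_step: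
  assumes st: "steep_curve \<theta> v a b w" and V: "large s V0" "V0 \<le> v a" and s: "0 < s"
    and diam: "\<And>i x y. x \<in> U i \<Longrightarrow> y \<in> U i \<Longrightarrow> \<bar>x - y\<bar> \<le> d i" and d: "\<And>i. 0 < d i"
    and mass: "hitting_mass s U d {a..b} \<le> ennreal ((1 / (2 * expand_hi (v a) * w)) powr s)"
    and \<theta>': "\<theta>' = (\<lambda>x. \<theta> x + C * v x powr \<gamma>)"
    and v': "v' = (\<lambda>x. v x + 2 * (A * cos (2 * pi * \<theta>' x)))"
  shows "\<exists>c e w'. a \<le> c \<and> e \<le> b \<and> 2 * w \<le> w' \<and> steep_curve \<theta>' v' c e w' \<and> v a + A \<le> v' c \<and>
    hitting_mass s U d {c..e} \<le> ennreal ((1 / (2 * expand_hi (v' c) * w')) powr s)"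
proof -
  define w' where "w' = w * expand_hi (v a)"
  \<comment> \<open>The integers \<open>j\<close> for which [j - 1/6, j - 1/12] fits between
    \<open>\<theta>' a\<close> and \<open>\<theta>' b\<close>.\<close>
  define K where "K = {\<lceil>\<theta>' a + 1/6\<rceil>..\<lfloor>\<theta>' b + 1/12\<rfloor>}"
  define P where "P j c e \<longleftrightarrow> a \<le> c \<and> e \<le> b \<and> steep_curve \<theta>' v' c e w' \<and>
    (\<forall>x\<in>{c..e}. j - 1/6 \<le> \<theta>' x \<and> \<theta>' x \<le> j - 1/12) \<and> v' c = v c + A" for j c e
  have L: "0 < v a" "48 \<le> expand_lo (v a)" "slope_hi \<le> expand_lo (v a)"
    "24 * expand_hi (v a + slope_hi + A) powr s \<le> expand_lo (v a)"
    using V unfolding large_def by auto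
  have ab: "a < b" "0 < w" "\<theta> b - \<theta> a = 1 / 12" using st unfolding steep_curve_def by auto
  note ex = expansion[OF st L(1) _ _ _ \<theta>']
  have len: "expand_lo (v a) / 12 \<le> \<theta>' b - \<theta>' a" using ex(1)[of a b] ab by simp
  \<comment> \<open>The count is at least \<open>expand_lo (v a) / 12 - 13/12\<close>, and
    \<open>expand_lo (v a) \<ge> 48\<close> leaves half of the main term.\<close>
  have cardK: "expand_lo (v a) / 24 \<le> card K"
    using card_ceiling_floor[of "\<theta>' b + 1/12" "\<theta>' a + 1/6"] len L(2) unfolding K_def by linarith
  have cardK0: "0 < card K" using cardK L(2) by (intro gr0I) simp
  have K: "finite K" "K \<noteq> {}" using cardK0 by (auto simp: card_gt_0_iff)
  have "\<exists>c e. P (of_int k) c e" if "k \<in> K" for k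
  proof -
    have "\<theta>' a \<le> of_int k - 1/6" "of_int k - 1/12 \<le> \<theta>' b"
      using that unfolding K_def by (simp_all add: ceiling_le_iff le_floor_iff algebra_simps)
    then show ?thesis
      using steep_curve_child[OF st L(1) L(3) \<theta>' v', folded w'_def, of "of_int k"]
      unfolding P_def by simp
  qed
  then obtain c e where ce: "\<And>k. k \<in> K \<Longrightarrow> P (of_int k) (c k) (e k)" by metis
  have hi: "1 \<le> expand_hi (v a)" by (rule expand_hi_ge_1)
  have hi2: "2 \<le> expand_hi (v a)"
  proof -
    have "expand_lo (v a) * (\<theta> b - \<theta> a) \<le> expand_hi (v a) * (\<theta> b - \<theta> a)"
      using ex(1,2)[of a b] ab by linarith
    then show ?thesis using L(2) ab by simp
  qed
  have w': "0 < w'" "2 * w \<le> w'" using ab hi2 by (auto simp: w'_def)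
  \<comment> \<open>A single member that meets the arc already contributes \<open>d i powr s\<close>
    to the mass. Its \<theta>'-image therefore has extent at most 1/2, whereas different children
    are at least 11/12 apart in \<theta>'.\<close>
  have small: "w' * d i \<le> 1 / 2" if "U i \<inter> {a..b} \<noteq> {}" for i
  proof -
    obtain x where "x \<in> U i" "x \<in> {a..b}" using \<open>U i \<inter> {a..b} \<noteq> {}\<close> by blast
    from hitting_mass_mem[where U = U and d = d and s = s, OF this] mass
    have "ennreal (d i powr s) \<le> ennreal ((1 / (2 * expand_hi (v a) * w)) powr s)"
      by (rule order_trans)
    then have "d i powr s \<le> (1 / (2 * expand_hi (v a) * w)) powr s" by (simp add: ennreal_le_iff)
    then have "d i \<le> 1 / (2 * expand_hi (v a) * w)"
      using powr_less_mono2[OF s, of "1 / (2 * expand_hi (v a) * w)" "d i"] ab hi by force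
    then show ?thesis using ab hi by (simp add: w'_def field_simps)
  qed
  have one: "k = l" if kl: "k \<in> K" "l \<in> K" "U i \<inter> {c k..e k} \<noteq> {}" "U i \<inter> {c l..e l} \<noteq> {}" for i k l
  proof -
    have False if kl: "k \<in> K" "l \<in> K" "U i \<inter> {c k..e k} \<noteq> {}" "U i \<inter> {c l..e l} \<noteq> {}" "k < l" for k l
    proof -
      obtain x where x: "x \<in> U i" "x \<in> {c k..e k}" using kl by blast
      obtain y where y: "y \<in> U i" "y \<in> {c l..e l}" using kl by blast
      have x': "\<theta>' x \<le> of_int k - 1/12" "x \<in> {a..b}" using ce[OF kl(1)] x unfolding P_def by auto
      have y': "of_int l - 1/6 \<le> \<theta>' y" "y \<in> {a..b}" using ce[OF kl(2)] y unfolding P_def by auto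
      have "of_int k + 1 \<le> (of_int l :: real)" using \<open>k < l\<close> by linarith
      then have big: "11/12 \<le> \<theta>' y - \<theta>' x" using x' y' by linarith
      have Dle: "\<bar>\<theta>' y - \<theta>' x\<bar> \<le> w' * \<bar>y - x\<bar>"
      proof (cases x y rule: linorder_cases)
        case less
        then show ?thesis using ex(3)[of x y] big x' y' by (simp add: w'_def)
      next
        case equal
        then show ?thesis by simp
      next
        case greater
        have "0 < expand_lo (v a) * (\<theta> x - \<theta> y)"
          using greater x' y' steep_curveD(1)[OF st, of y x] L(2) by (intro mult_pos_pos) auto
        then have "\<theta>' y < \<theta>' x" using ex(1)[of y x] greater x' y' by simp
        then show ?thesis using big by simp
      qed
      also have "\<dots> \<le> w' * d i" using diam[OF y(1) x(1)] w' by (intro mult_left_mono) auto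
      also have "\<dots> \<le> 1 / 2" using small x(1) x'(2) by blast
      finally show False using big by simp
    qed
    from this[of k l] this[of l k] kl show ?thesis by (cases k l rule: linorder_cases) auto
  qed
  have "\<exists>k\<in>K. hitting_mass s U d {c k..e k} \<le>
      ennreal ((1 / (2 * expand_hi (v a) * w)) powr s / card K)"
  proof (rule hitting_mass_pigeonhole[OF K _ one mass])
    show "{c k..e k} \<subseteq> {a..b}" if "k \<in> K" for k using ce[OF that] unfolding P_def by auto
  qed auto
  then obtain k where k: "k \<in> K" "hitting_mass s U d {c k..e k} \<le>
      ennreal ((1 / (2 * expand_hi (v a) * w)) powr s / card K)" by blast
  have Pk: "a \<le> c k" "e k \<le> b" "steep_curve \<theta>' v' (c k) (e k) w'" "v' (c k) = v (c k) + A"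
    using ce[OF k(1)] unfolding P_def by auto
  have cek: "c k < e k" using Pk(3) unfolding steep_curve_def by blast
  have vc: "v a \<le> v (c k)" "v (c k) \<le> v a + slope_hi"
    using steep_curve_min[OF st, of "c k"] steep_curve_max[OF st, of "c k"] Pk cek by auto
  \<comment> \<open>The child begins at velocity \<open>v (c k) + A\<close>, at most
    \<open>v a + slope_hi + A\<close>, which is the argument that appears in
    \<open>large\<close>.\<close>
  have hi': "expand_hi (v' (c k)) \<le> expand_hi (v a + slope_hi + A)"
    using vc L(1) A Pk(4) by (intro expand_hi_mono) auto
  have "24 * expand_hi (v' (c k)) powr s \<le> expand_lo (v a)"
    using powr_mono2[OF _ _ hi', of s] s expand_hi_ge_1[of "v' (c k)"] L(4) by linarith
  then have "expand_hi (v' (c k)) powr s \<le> card K" using cardK by linarith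
  then have "(1 / (2 * expand_hi (v a) * w)) powr s / card K
      \<le> (1 / (2 * expand_hi (v a) * w)) powr s / expand_hi (v' (c k)) powr s"
    using cardK0 expand_hi_ge_1[of "v' (c k)"] by (intro divide_left_mono mult_pos_pos) auto
  \<comment> \<open>The old factor \<open>expand_hi (v a)\<close> merges with \<open>w\<close> into
    \<open>w'\<close>, and the new one takes its place.\<close>
  also have "\<dots> = (1 / (2 * expand_hi (v' (c k)) * w')) powr s"
    using expand_hi_ge_1[of "v' (c k)"] hi ab
    by (simp add: w'_def powr_divide powr_mult mult_ac)
  finally have "hitting_mass s U d {c k..e k} \<le> ennreal ((1 / (2 * expand_hi (v' (c k)) * w')) powr s)"
    using k(2) by (meson ennreal_leI order_trans)
  then show ?thesis using Pk vc w' A by (intro exI[of _ "c k"] exI[of _ "e k"] exI[of _ w']) auto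
qed

text \<open>Both expansion bounds are of order V^p with p = \<gamma> - 1. As s < 1, the power V^(p
  s) on the upper side is eventually dominated by V^p, the surplus V^(p (1 - s)) beating the
  constants.\<close>

lemma ex_large:
  assumes s: "0 < s" "s < 1"
  shows "\<exists>V0. large s V0"
proof -
  define p where "p = \<gamma> - 1"
  define a where "a = C * \<gamma> * slope_lo"
  define K where "K = 1 + C * \<gamma> * 2 powr p * slope_hi"
  have pos: "0 < p" "0 < a" "1 \<le> K" using \<gamma> C slope_pos by (auto simp: p_def a_def K_def)
  have top: "filterlim (\<lambda>V. a * V powr q) at_top at_top" if "0 < q" for q
  proof -
    have "filterlim (\<lambda>V. a * exp (q * ln V)) at_top at_top"
      using pos that
      by (intro filterlim_tendsto_pos_mult_at_top[OF tendsto_const] filterlim_compose[OF exp_at_top] ln_at_top)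
        auto
    moreover have "\<forall>\<^sub>F V in at_top. a * exp (q * ln V) = a * V powr q"
      using eventually_gt_at_top[of 0] by eventually_elim (simp add: powr_def)
    ultimately show ?thesis using filterlim_cong[OF refl refl] by fast
  qed
  have "\<forall>\<^sub>F V in at_top. max 48 slope_hi \<le> a * V powr p"
    "\<forall>\<^sub>F V in at_top. 24 * K powr s \<le> a * V powr (p * (1 - s))"
    using top[of p] top[of "p * (1 - s)"] pos s unfolding filterlim_at_top by (blast, simp)
  \<comment> \<open>\<open>2 * slope_hi + A \<le> V\<close> bounds the base inside
    \<open>expand_hi\<close> by \<open>2 * V\<close>, whence the factor \<open>2 powr p\<close> in
    \<open>K\<close>; \<open>1 \<le> V\<close> lets the summand 1 be absorbed into
    \<open>V powr p\<close>.\<close>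
  moreover have "\<forall>\<^sub>F V in at_top. max 1 (2 * slope_hi + A) \<le> (V :: real)" by (rule eventually_ge_at_top)
  ultimately have "\<forall>\<^sub>F V in at_top. max 48 slope_hi \<le> a * V powr p \<and>
    24 * K powr s \<le> a * V powr (p * (1 - s)) \<and> max 1 (2 * slope_hi + A) \<le> V"
    by eventually_elim auto
  then obtain V0 where V0: "\<And>V. V0 \<le> V \<Longrightarrow> max 48 slope_hi \<le> a * V powr p \<and>
    24 * K powr s \<le> a * V powr (p * (1 - s)) \<and> max 1 (2 * slope_hi + A) \<le> V"
    unfolding eventually_at_top_linorder by blast
  have lo: "expand_lo V = 1 + a * V powr p" for V
    by (simp add: expand_lo_def a_def p_def mult_ac)
  have "24 * expand_hi (V + slope_hi + A) powr s \<le> expand_lo V" if "V0 \<le> V" for V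
  proof -
    have V: "1 \<le> V" "2 * slope_hi + A \<le> V" "24 * K powr s \<le> a * V powr (p * (1 - s))"
      using V0[OF that] by auto
    have "(V + slope_hi + A + slope_hi) powr p \<le> (2 * V) powr p"
      using V A slope_pos pos by (intro powr_mono2) auto
    then have "expand_hi (V + slope_hi + A) \<le> 1 + C * \<gamma> * (2 powr p * V powr p) * slope_hi"
      using V C \<gamma> slope_pos unfolding expand_hi_def p_def[symmetric]
      by (simp add: powr_mult mult.assoc)
    also have "\<dots> \<le> K * V powr p"
      using V pos ge_one_powr_ge_zero[of V p] by (simp add: K_def algebra_simps)
    finally have "expand_hi (V + slope_hi + A) powr s \<le> (K * V powr p) powr s"
      using s expand_hi_ge_1[of "V + slope_hi + A"] by (intro powr_mono2) auto
    also have "\<dots> = K powr s * V powr (p * s)" using pos by (simp add: powr_mult powr_powr)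
    finally have "24 * expand_hi (V + slope_hi + A) powr s \<le> 24 * K powr s * V powr (p * s)" by simp
    also have "\<dots> \<le> a * V powr (p * (1 - s)) * V powr (p * s)"
      using V by (intro mult_right_mono) auto
    also have "\<dots> = a * V powr p"
      using V by (simp add: mult.assoc powr_add[symmetric] algebra_simps)
    finally show ?thesis by (simp add: lo)
  qed
  moreover have "48 \<le> expand_lo V \<and> slope_hi \<le> expand_lo V" if "V0 \<le> V" for V
    using V0[OF that] by (simp add: lo)
  moreover have "0 < V0" using V0[of V0] by simp
  ultimately show ?thesis unfolding large_def by blast
qed

end

section \<open>Lifted orbits and escaping points outside a given family of sets\<close>

context wall
begin

text \<open>The wall map lifted to the universal cover: times are not reduced modulo 1, so they can
  be monotone along a curve.\<close>

definition lift_map :: "real \<times> real \<Rightarrow> real \<times> real" where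
  "lift_map = (\<lambda>(x, v). (x + C * v powr \<gamma>, v + 2 * (A * cos (2 * pi * (x + C * v powr \<gamma>)))))"

lemma lift_map_apply: "lift_map p =
    (fst p + C * snd p powr \<gamma>, snd p + 2 * (A * cos (2 * pi * (fst p + C * snd p powr \<gamma>))))"
  by (simp add: lift_map_def split_beta)

definition lift_time :: "nat \<Rightarrow> real \<Rightarrow> real \<Rightarrow> real" where
  "lift_time n v0 x = fst ((lift_map ^^ n) (x, v0))"

definition lift_vel :: "nat \<Rightarrow> real \<Rightarrow> real \<Rightarrow> real" where
  "lift_vel n v0 x = snd ((lift_map ^^ n) (x, v0))"

lemma lift_0: "lift_time 0 v0 x = x" "lift_vel 0 v0 x = v0"
  by (simp_all add: lift_time_def lift_vel_def)

lemma lift_Suc: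
  "lift_time (Suc n) v0 = (\<lambda>x. lift_time n v0 x + C * lift_vel n v0 x powr \<gamma>)"
  "lift_vel (Suc n) v0 =
     (\<lambda>x. lift_vel n v0 x + 2 * (A * cos (2 * pi * lift_time (Suc n) v0 x)))"
  by (simp_all add: fun_eq_iff lift_time_def lift_vel_def lift_map_apply)

text \<open>A line of constant initial velocity has slope 0 and is not steep, so curves start after
  one step. That step translates time by \<open>C * v0 powr \<gamma>\<close>; the arc is shifted
  back accordingly.\<close>

lemma steep_curve_initial:
  "steep_curve (lift_time (Suc 0) v0) (lift_vel (Suc 0) v0) (- C * v0 powr \<gamma> - 1/6) (- C * v0 powr \<gamma> - 1/12) 1"
  "lift_vel (Suc 0) v0 (- C * v0 powr \<gamma> - 1/6) = v0 + A"
proof -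
  have T: "lift_time (Suc 0) v0 x = x + C * v0 powr \<gamma>" for x
    by (simp only: lift_Suc lift_0)
  have V: "lift_vel (Suc 0) v0 x = v0 + 2 * (A * cos (2 * pi * (x + C * v0 powr \<gamma>)))" for x
    by (simp only: lift_Suc lift_0)
  have "- C * v0 powr \<gamma> - 1/6 + C * v0 powr \<gamma> = 0 - 1/6" by simp
  then show "lift_vel (Suc 0) v0 (- C * v0 powr \<gamma> - 1/6) = v0 + A"
    using cos_left_endpoint[OF Ints_0] by (simp only: V)
  have "slope_lo * (y - x) \<le> lift_vel (Suc 0) v0 y - lift_vel (Suc 0) v0 x \<and>
      lift_vel (Suc 0) v0 y - lift_vel (Suc 0) v0 x \<le> slope_hi * (y - x)"
    if "- C * v0 powr \<gamma> - 1/6 \<le> x" "x < y" "y \<le> - C * v0 powr \<gamma> - 1/12" for x y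
  proof -
    define q where "q = y - x"
    note cs = cos_diff_bounds[of 0 "x + C * v0 powr \<gamma>" "y + C * v0 powr \<gamma>"]
    have "2 * A * (pi * q) \<le> lift_vel (Suc 0) v0 y - lift_vel (Suc 0) v0 x"
      using mult_left_mono[OF cs(1), of "2 * A"] that A by (simp add: V algebra_simps q_def)
    moreover have "lift_vel (Suc 0) v0 y - lift_vel (Suc 0) v0 x \<le> 2 * A * (2 * pi * q)"
      using mult_left_mono[OF cs(2), of "2 * A"] that A by (simp add: V algebra_simps q_def)
    moreover have "0 < q" using that by (simp add: q_def)
    ultimately show ?thesis
      unfolding slope_lo_def slope_hi_def q_def[symmetric] by (simp add: algebra_simps)
  qed
  then show "steep_curve (lift_time (Suc 0) v0) (lift_vel (Suc 0) v0)
      (- C * v0 powr \<gamma> - 1/6) (- C * v0 powr \<gamma> - 1/12) 1"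
    unfolding steep_curve_def by (auto simp: T intro!: bexI[of _ 0])
qed

text \<open>Iterating \<open>steep_curve_step\<close> gives nested arcs whose masses tend to 0. A
  common point cannot lie in any \<open>U i\<close>, since \<open>d i powr s\<close> would be below
  all these masses, and its velocity grows by \<open>A\<close> per step on the lower bound.\<close>

lemma escaping_point_outside:
  assumes V: "large s V0" "V0 \<le> v0" and s: "0 < s"
    and diam: "\<And>i x y. x \<in> U i \<Longrightarrow> y \<in> U i \<Longrightarrow> \<bar>x - y\<bar> \<le> d i" and d: "\<And>i. 0 < d i"
  defines "J \<equiv> {- C * v0 powr \<gamma> - 1/6 .. - C * v0 powr \<gamma> - 1/12}"
  assumes mass: "hitting_mass s U d J \<le> ennreal ((1 / (2 * expand_hi (v0 + A))) powr s)"
  shows "\<exists>x\<in>J. (\<forall>i. x \<notin> U i) \<and> (\<forall>n. v0 + n * A \<le> lift_vel n v0 x)"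
proof -
  \<comment> \<open>Stage \<open>n\<close> describes the curve after \<open>Suc n\<close> steps,
    because the first steep curve appears after one step.\<close>
  define P where "P n z \<longleftrightarrow> (case z of (a, b, w) \<Rightarrow>
      steep_curve (lift_time (Suc n) v0) (lift_vel (Suc n) v0) a b w \<and>
      v0 + Suc n * A \<le> lift_vel (Suc n) v0 a \<and> 2 ^ n \<le> w \<and>
      hitting_mass s U d {a..b} \<le>
        ennreal ((1 / (2 * expand_hi (lift_vel (Suc n) v0 a) * w)) powr s))" for n z
  define Q where "Q z z' \<longleftrightarrow> (case z of (a, b, w :: real) \<Rightarrow> case z' of (c, e, w' :: real) \<Rightarrow>
      a \<le> c \<and> e \<le> b)" for z z' :: "real \<times> real \<times> real"
  define z0 where "z0 = (- C * v0 powr \<gamma> - 1/6, - C * v0 powr \<gamma> - 1/12, 1 :: real)"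
  \<comment> \<open>The clause for \<open>n = 0\<close> pins the first arc to \<open>J\<close>, so
    that the limit point lies in \<open>J\<close>.\<close>
  have "\<exists>f. \<forall>n. (P n (f n) \<and> (n = 0 \<longrightarrow> f n = z0)) \<and> Q (f n) (f (Suc n))"
  proof (rule dependent_nat_choice)
    show "\<exists>x. P 0 x \<and> (0 = (0::nat) \<longrightarrow> x = z0)"
      using steep_curve_initial[of v0] mass unfolding P_def z0_def J_def by auto
  next
    fix z :: "real \<times> real \<times> real" and n :: nat
    assume "P n z \<and> (n = 0 \<longrightarrow> z = z0)"
    moreover obtain a b w where z: "z = (a, b, w)" by (cases z) auto
    ultimately have Pz: "steep_curve (lift_time (Suc n) v0) (lift_vel (Suc n) v0) a b w"
      "v0 + Suc n * A \<le> lift_vel (Suc n) v0 a" "2 ^ n \<le> w"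
      "hitting_mass s U d {a..b} \<le>
        ennreal ((1 / (2 * expand_hi (lift_vel (Suc n) v0 a) * w)) powr s)"
      unfolding P_def by auto
    have "V0 \<le> lift_vel (Suc n) v0 a"
      using Pz(2) V(2) A mult_nonneg_nonneg[of "real (Suc n)" A] by linarith
    from steep_curve_step[OF Pz(1) V(1) this s diam d Pz(4) lift_Suc(1) lift_Suc(2)]
    obtain c e w' where "a \<le> c" "e \<le> b" "2 * w \<le> w'"
      "steep_curve (lift_time (Suc (Suc n)) v0) (lift_vel (Suc (Suc n)) v0) c e w'"
      "lift_vel (Suc n) v0 a + A \<le> lift_vel (Suc (Suc n)) v0 c"
      "hitting_mass s U d {c..e} \<le>
        ennreal ((1 / (2 * expand_hi (lift_vel (Suc (Suc n)) v0 c) * w')) powr s)"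
      by blast
    with Pz have "P (Suc n) (c, e, w')" "Q z (c, e, w')"
      unfolding P_def Q_def z by (auto simp: algebra_simps)
    then show "\<exists>y. (P (Suc n) y \<and> (Suc n = 0 \<longrightarrow> y = z0)) \<and> Q z y" by blast
  qed
  then obtain f where f: "\<And>n. P n (f n)" "f 0 = z0" "\<And>n. Q (f n) (f (Suc n))" by blast
  define a b w where "a n = fst (f n)" and "b n = fst (snd (f n))" and "w n = snd (snd (f n))" for n
  have fn: "f n = (a n, b n, w n)" for n by (simp add: a_def b_def w_def)
  have st: "steep_curve (lift_time (Suc n) v0) (lift_vel (Suc n) v0) (a n) (b n) (w n)"
    and vel: "v0 + Suc n * A \<le> lift_vel (Suc n) v0 (a n)" and w: "2 ^ n \<le> w n"
    and m: "hitting_mass s U d {a n..b n} \<le>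
        ennreal ((1 / (2 * expand_hi (lift_vel (Suc n) v0 (a n)) * w n)) powr s)" for n
    using f(1)[of n] unfolding fn P_def by auto
  have J0: "{a 0..b 0} = J" using f(2) by (simp add: fn z0_def J_def)
  have nest: "a n \<le> a (Suc n)" "b (Suc n) \<le> b n" for n
    using f(3)[of n] unfolding fn Q_def by auto
  have "antimono (\<lambda>n. {a n..b n})" using nest by (intro decseq_SucI) auto
  moreover have "a n \<le> b n" for n using st[of n] unfolding steep_curve_def by auto
  ultimately have "\<Inter> (range (\<lambda>n. {a n..b n})) \<noteq> {}"
    by (intro compact_nest) (auto dest: antimonoD)
  then obtain x where x: "\<And>n. x \<in> {a n..b n}" by blast
  have "x \<notin> U i" for i
  proof
    assume xi: "x \<in> U i"
    \<comment> \<open>The point lies in every arc, so \<open>U i\<close> meets every arc and its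
      cost is bounded by each mass; \<open>w n \<ge> 2 ^ n\<close> supplies the decay.\<close>
    have "d i \<le> (1/2) ^ n" for n
    proof -
      define D where "D = expand_hi (lift_vel (Suc n) v0 (a n))"
      have D: "1 \<le> D" unfolding D_def by (rule expand_hi_ge_1)
      have wpos: "0 < w n" using w[of n] by (smt (verit) zero_less_power)
      have "ennreal (d i powr s) \<le> ennreal ((1 / (2 * D * w n)) powr s)"
        using hitting_mass_mem[where U = U and d = d and s = s, OF xi x[of n]] m[of n]
        unfolding D_def by (rule order_trans)
      then have "d i powr s \<le> (1 / (2 * D * w n)) powr s" by (simp add: ennreal_le_iff)
      then have "d i \<le> 1 / (2 * D * w n)"
        using powr_less_mono2[OF s, of "1 / (2 * D * w n)" "d i"] D wpos by force
      also have "\<dots> \<le> 1 / 2 ^ n"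
        using D w[of n] wpos mult_mono[of 1 "2 * D" "2 ^ n" "w n"] by (intro divide_left_mono) auto
      finally show ?thesis by (simp add: power_one_over)
    qed
    then have "d i \<le> 0"
      by (intro LIMSEQ_le_const[OF LIMSEQ_realpow_zero[of "1/2"]]) auto
    then show False using d[of i] by simp
  qed
  moreover have "v0 + n * A \<le> lift_vel n v0 x" for n
  proof (cases n)
    case 0
    then show ?thesis by (simp add: lift_0)
  next
    case (Suc k)
    then show ?thesis using vel[of k] steep_curve_min[OF st, of k x] x[of k] by auto
  qed
  moreover have "x \<in> J" using x[of 0] J0 by simp
  ultimately show ?thesis by blast
qed

lemma static_wall_map_lift:
  fixes B :: real
  defines "F \<equiv> static_wall_map (\<lambda>v. C * v powr \<gamma>) (\<lambda>t. B + A / (2 * pi) * sin (2 * pi * t))"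
  shows "(F ^^ n) (circle_of x, v0) = (circle_of (lift_time n v0 x), lift_vel n v0 x)"
proof (induction n)
  case 0
  show ?case by (simp add: lift_0)
next
  case (Suc n)
  have add: "circle_of y + circle_of z = circle_of (y + z)" for y z
    by (simp add: plus_circle.abs_eq)
  have "F (circle_of y, v) =
      (circle_of (y + C * v powr \<gamma>), v + 2 * (A * cos (2 * pi * (y + C * v powr \<gamma>))))" for y v
    unfolding F_def static_wall_map_def by (simp only: prod.case add on_circle_deriv_wall)
  then show ?case using Suc by (simp add: lift_Suc)
qed

lemma escaping_setI:
  fixes B :: real
  assumes "0 < v0" "\<And>n. v0 + real n * A \<le> lift_vel n v0 x"
  shows "(circle_of x, v0) \<in> escaping_set
    (static_wall_map (\<lambda>v. C * v powr \<gamma>) (\<lambda>t. B + A / (2 * pi) * sin (2 * pi * t)))"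
proof -
  have "filterlim (\<lambda>n. v0 + real n * A) at_top sequentially"
    using A by (intro filterlim_tendsto_add_at_top[OF tendsto_const] filterlim_at_top_mult_tendsto_pos
        [OF tendsto_const] filterlim_real_sequentially)
  then have "filterlim (\<lambda>n. lift_vel n v0 x) at_top sequentially"
    by (rule filterlim_at_top_mono) (use assms in simp)
  moreover have "0 < lift_vel n v0 x" for n
    using assms(1) assms(2)[of n] A mult_nonneg_nonneg[of "real n" A] by linarith
  ultimately show ?thesis
    unfolding escaping_set_def mem_Collect_eq static_wall_map_lift snd_conv by blast
qed

end

section \<open>Distances on the circle and the upper bound for the dimension\<close>

text \<open>Within distance 1/2 no integer is nearer to \<open>x - y\<close> than 0.\<close>

lemma dist_circle_of:
  assumes "\<bar>x - y\<bar> \<le> 1 / 2"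
  shows "dist (circle_of x) (circle_of y) = \<bar>x - y\<bar>"
proof -
  have "infdist (x - y) \<int> = \<bar>x - y\<bar>"
  proof (rule antisym)
    show "infdist (x - y) \<int> \<le> \<bar>x - y\<bar>"
      using infdist_le[of 0 "\<int> :: real set" "x - y"] by (simp add: dist_real_def)
    obtain m where m: "m \<in> \<int>" "infdist (x - y) \<int> = dist (x - y) m"
      using infdist_attains_inf[of "\<int> :: real set" "x - y"] closed_Ints Ints_0 by blast
    have "m = 0 \<or> 1 \<le> \<bar>m\<bar>" using Ints_nonzero_abs_ge1[OF m(1)] by blast
    then show "\<bar>x - y\<bar> \<le> infdist (x - y) \<int>"
      using assms unfolding m(2) dist_real_def by linarith
  qed
  then show ?thesis by (simp add: dist_circle.abs_eq)
qed

lemma dist_circle_of_le: "dist (circle_of x) (circle_of y) \<le> \<bar>x - y\<bar>"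
  using infdist_le[of 0 "\<int> :: real set" "x - y"] by (simp add: dist_circle.abs_eq dist_real_def)

lemma diameter_le_dist:
  fixes S :: "'a::metric_space set"
  assumes "0 \<le> d" "\<And>x y. x \<in> S \<Longrightarrow> y \<in> S \<Longrightarrow> dist x y \<le> d"
  shows "diameter S \<le> d"
  using assms by (auto simp: diameter_def intro!: cSUP_least)

lemma hausdorff_premeasure_le_cover:
  fixes U :: "nat \<Rightarrow> 'a::metric_space set"
  assumes "S \<subseteq> (\<Union>i. U i)" "\<And>i. bounded (U i)" "\<And>i. diameter (U i) \<le> \<delta>"
  shows "hausdorff_premeasure s \<delta> S \<le> (\<Sum>i. diam_powr s (U i))"
  unfolding hausdorff_premeasure_def using assms by (intro Inf_lower) auto

text \<open>Covering sets of diameter at most 1 cost less for a larger exponent. The scale 1 is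
  enough for lower bounds, because the Hausdorff measure is a supremum over all scales.\<close>

lemma hausdorff_premeasure_mono_exponent:
  fixes S :: "'a::metric_space set"
  assumes "0 \<le> r" "r \<le> s" "0 < s"
  shows "hausdorff_premeasure s 1 S \<le> hausdorff_premeasure r 1 S"
proof -
  have "diam_powr s U \<le> diam_powr r U" if "bounded U" "diameter U \<le> 1" for U :: "'a set"
    using that assms diameter_ge_0[OF that(1)]
    by (auto simp: diam_powr_def powr_le1 intro!: powr_mono')
  then show ?thesis
    unfolding hausdorff_premeasure_def by (intro Inf_mono) (auto intro!: suminf_le)
qed

text \<open>The strip of velocities in [m, m + 1] is cut into N^2 cells of side 1/N;
  \<open>l mod N\<close> and \<open>l div N\<close> are the time and velocity indices, and larger
  \<open>l\<close> give empty cells so that \<open>l\<close> can range over all naturals.\<close>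

definition grid_cell :: "nat \<Rightarrow> nat \<Rightarrow> nat \<Rightarrow> (circle \<times> real) set" where
  "grid_cell N m l = (if l < N\<^sup>2 then
     circle_of ` {real (l mod N) / N .. real (l mod N + 1) / N} \<times>
       {m + real (l div N) / N .. m + real (l div N + 1) / N} else {})"

lemma grid_cell_dist:
  assumes "0 < N" "p \<in> grid_cell N m l" "q \<in> grid_cell N m l"
  shows "dist p q \<le> 2 / N"
proof -
  have le: "\<bar>x - y\<bar> \<le> 1 / N" if "x \<in> {z + real i / N .. z + real (i + 1) / N}"
    "y \<in> {z + real i / N .. z + real (i + 1) / N}" for x y z i
    using that by (auto simp: add_divide_distrib abs_le_iff)
  obtain x v y u where p: "p = (circle_of x, v)" and q: "q = (circle_of y, u)"
    and xy: "x \<in> {0 + real (l mod N) / N .. 0 + real (l mod N + 1) / N}"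
      "y \<in> {0 + real (l mod N) / N .. 0 + real (l mod N + 1) / N}"
    and vu: "v \<in> {m + real (l div N) / N .. m + real (l div N + 1) / N}"
      "u \<in> {m + real (l div N) / N .. m + real (l div N + 1) / N}"
    using assms(2,3) unfolding grid_cell_def by (auto split: if_splits)
  have "dist p q \<le> dist (circle_of x) (circle_of y) + dist v u"
    unfolding p q dist_Pair_Pair by (rule sqrt_sum_squares_le_sum) auto
  also have "\<dots> \<le> \<bar>x - y\<bar> + \<bar>v - u\<bar>" using dist_circle_of_le by (simp add: dist_real_def)
  also have "\<dots> \<le> 2 / N" using le[OF xy] le[OF vu] by simp
  finally show ?thesis .
qed

lemma grid_cell_cover:
  assumes N: "0 < N" and v: "0 < v"
  shows "\<exists>l. (t, v) \<in> grid_cell N (nat \<lfloor>v\<rfloor>) l"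
proof -
  \<comment> \<open>The representative of a circle point is some real number; its fractional part
    lies in [0, 1).\<close>
  define x where "x = frac (rep_circle t)"
  define y where "y = v - \<lfloor>v\<rfloor>"
  have t: "t = circle_of x"
  proof -
    have "circle_of (rep_circle t) = t" by (rule Quotient3_abs_rep[OF Quotient3_circle])
    moreover have "circle_of x = circle_of (rep_circle t)"
      unfolding circle.abs_eq_iff x_def frac_def by simp
    ultimately show ?thesis by simp
  qed
  define i where "i = nat \<lfloor>x * N\<rfloor>"
  define j where "j = nat \<lfloor>y * N\<rfloor>"
  have cell: "nat \<lfloor>z * N\<rfloor> < N \<and> real (nat \<lfloor>z * N\<rfloor>) / N \<le> z \<and> z \<le> real (nat \<lfloor>z * N\<rfloor> + 1) / N"
    if z: "0 \<le> z" "z < 1" for z :: real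
  proof -
    have zN: "0 \<le> z * N" "z * N < N" using z N by auto
    then have "real (nat \<lfloor>z * N\<rfloor>) = of_int \<lfloor>z * N\<rfloor>" by simp
    then have "real (nat \<lfloor>z * N\<rfloor>) \<le> z * N" "z * N \<le> real (nat \<lfloor>z * N\<rfloor> + 1)"
      by linarith+
    moreover from this zN have "real (nat \<lfloor>z * N\<rfloor>) < real N" by linarith
    ultimately show ?thesis using N by (simp add: field_simps)
  qed
  have x: "i < N" "real i / N \<le> x" "x \<le> real (i + 1) / N"
    using cell[of x] frac_lt_1 frac_ge_0 unfolding i_def x_def by auto
  have "0 \<le> y" "y < 1" unfolding y_def by linarith+
  then have y: "j < N" "real j / N \<le> y" "y \<le> real (j + 1) / N"
    using cell[of y] unfolding j_def by auto
  have l: "(j * N + i) mod N = i" "(j * N + i) div N = j" using x(1) by auto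
  have "j * N + i < (j + 1) * N" using x(1) by simp
  also have "\<dots> \<le> N * N" using y(1) by (intro mult_le_mono) auto
  finally have "j * N + i < N\<^sup>2" by (simp add: power2_eq_square)
  moreover have "v = real (nat \<lfloor>v\<rfloor>) + y" using v by (simp add: y_def)
  ultimately have "(t, v) \<in> grid_cell N (nat \<lfloor>v\<rfloor>) (j * N + i)"
    unfolding grid_cell_def l using x y t by auto
  then show ?thesis by blast
qed

text \<open>The half plane is a countable union of strips of height 1, and each strip receives its
  own mesh.\<close>

lemma hausdorff_measure_upper_half:
  fixes S :: "(circle \<times> real) set"
  assumes s: "2 < s" and S: "\<And>p. p \<in> S \<Longrightarrow> 0 < snd p"
  shows "hausdorff_measure s S = 0"
proof -
  have "hausdorff_premeasure s \<delta> S \<le> ennreal \<epsilon>" if \<delta>: "0 < \<delta>" and \<epsilon>: "0 < \<epsilon>" for \<delta> \<epsilon>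
  proof -
    \<comment> \<open>For s > 2 the cost N^2 (2/N)^s of a strip tends to 0, so the strip
      \<open>m\<close> can be given the share 2^(-m-1) of \<epsilon>.\<close>
    have "\<exists>N. 0 < N \<and> 2 / real N \<le> \<delta> \<and> real (N\<^sup>2) * (2 / N) powr s \<le> \<epsilon> * (1/2) ^ Suc m" for m
    proof -
      have "(\<lambda>n. 2 powr s * real n powr (2 - s)) \<longlonglongrightarrow> 2 powr s * 0"
        using s by (intro tendsto_mult tendsto_const tendsto_neg_powr filterlim_real_sequentially) auto
      then have "\<forall>\<^sub>F n in sequentially. 2 powr s * real n powr (2 - s) < \<epsilon> * (1/2) ^ Suc m"
        by (rule order_tendstoD) (use \<epsilon> in simp)
      moreover have "\<forall>\<^sub>F n in sequentially. max 1 (nat \<lceil>2 / \<delta>\<rceil>) \<le> n" by (rule eventually_ge_at_top)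
      ultimately have "\<forall>\<^sub>F n in sequentially.
          2 powr s * real n powr (2 - s) < \<epsilon> * (1/2) ^ Suc m \<and> max 1 (nat \<lceil>2 / \<delta>\<rceil>) \<le> n"
        by (rule eventually_conj)
      then obtain n where n: "2 powr s * real n powr (2 - s) < \<epsilon> * (1/2) ^ Suc m"
        "max 1 (nat \<lceil>2 / \<delta>\<rceil>) \<le> n"
        using eventually_happens trivial_limit_sequentially by blast
      have n0: "0 < n" "2 / \<delta> \<le> n" using n(2) by linarith+
      have "real (n\<^sup>2) * (2 / n) powr s = 2 powr s * real n powr (2 - s)"
        using n0 by (simp add: powr_divide powr_diff powr_numeral)
      then show ?thesis using n n0 \<delta> by (intro exI[of _ n]) (auto simp: field_simps)
    qed
    then obtain N :: "nat \<Rightarrow> nat" where N: "\<And>m. 0 < N m" "\<And>m. 2 / real (N m) \<le> \<delta>"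
      "\<And>m. real ((N m)\<^sup>2) * (2 / N m) powr s \<le> \<epsilon> * (1/2) ^ Suc m" by metis
    define f where "f = (\<lambda>(m, l). diam_powr s (grid_cell (N m) m l))"
    define U where "U i = (case prod_decode i of (m, l) \<Rightarrow> grid_cell (N m) m l)" for i
    have dist: "dist p q \<le> \<delta>" if "p \<in> U i" "q \<in> U i" for i p q
    proof -
      obtain m l where "prod_decode i = (m, l)" by (cases "prod_decode i") auto
      then show ?thesis
        using that order_trans[OF grid_cell_dist[OF N(1)] N(2)] unfolding U_def by simp
    qed
    have row: "(\<Sum>l. f (m, l)) \<le> ennreal (\<epsilon> * (1/2) ^ Suc m)" for m
    proof -
      have "(\<Sum>l. f (m, l)) = (\<Sum>l<(N m)\<^sup>2. f (m, l))"
        by (rule suminf_finite) (auto simp: f_def grid_cell_def diam_powr_def)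
      also have "\<dots> \<le> (\<Sum>l<(N m)\<^sup>2. ennreal ((2 / N m) powr s))"
      proof (rule sum_mono)
        fix l
        have "diameter (grid_cell (N m) m l) \<le> 2 / N m"
          using grid_cell_dist[OF N(1)] by (intro diameter_le_dist) auto
        moreover have "bounded (grid_cell (N m) m l)"
          using grid_cell_dist[OF N(1)] unfolding bounded_def by blast
        ultimately show "f (m, l) \<le> ennreal ((2 / N m) powr s)"
          using s diameter_ge_0 unfolding f_def diam_powr_def
          by (auto intro!: ennreal_leI powr_mono2)
      qed
      also have "\<dots> = ennreal (real ((N m)\<^sup>2) * (2 / N m) powr s)"
        by (simp only: sum_constant card_lessThan ennreal_of_nat_eq_real_of_nat)
          (simp flip: ennreal_mult)
      also have "\<dots> \<le> ennreal (\<epsilon> * (1/2) ^ Suc m)" by (intro ennreal_leI N)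
      finally show ?thesis .
    qed
    have "S \<subseteq> (\<Union>i. U i)"
    proof
      fix p assume "p \<in> S"
      then obtain t v where p: "p = (t, v)" "0 < v" using S by (cases p) fastforce
      then obtain l where "p \<in> grid_cell (N (nat \<lfloor>v\<rfloor>)) (nat \<lfloor>v\<rfloor>) l"
        using grid_cell_cover[OF N(1)] by blast
      then have "p \<in> U (prod_encode (nat \<lfloor>v\<rfloor>, l))" by (simp add: U_def)
      then show "p \<in> (\<Union>i. U i)" by blast
    qed
    moreover have "bounded (U i)" for i using dist unfolding bounded_def by blast
    moreover have "diameter (U i) \<le> \<delta>" for i using dist \<delta> by (intro diameter_le_dist) auto
    ultimately have "hausdorff_premeasure s \<delta> S \<le> (\<Sum>i. diam_powr s (U i))"
      by (rule hausdorff_premeasure_le_cover)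
    also have "\<dots> = (\<Sum>i. f (prod_decode i))" by (simp add: U_def f_def split_beta)
    also have "\<dots> = (\<Sum>m. \<Sum>l. f (m, l))" by (rule suminf_ennreal_2dimen) simp
    also have "\<dots> \<le> (\<Sum>m. ennreal (\<epsilon> * (1/2) ^ Suc m))" by (intro suminf_le row) auto
    also have "\<dots> = ennreal (\<epsilon> * 1)"
      using \<epsilon> by (intro suminf_ennreal_eq sums_mult power_half_series) auto
    finally show ?thesis by simp
  qed
  then have "hausdorff_premeasure s \<delta> S = 0" if "0 < \<delta>" for \<delta>
    using that by (metis ennreal_le_epsilon add_0 le_zero_eq zero_less_one ennreal_less_top)
  then show ?thesis unfolding hausdorff_measure_def by simp
qed

section \<open>Slicing a cover by velocity\<close>

text \<open>A Fubini argument: a set of size \<open>d i\<close> is seen only for velocities in an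
  interval of length \<open>2 * d i\<close>, so the s-dimensional sums of the slices integrate to at
  most twice the (1 + s)-dimensional sum. Some slice in any unit interval is no worse than the
  integral.\<close>

lemma slice_cover:
  fixes E :: "('a::metric_space \<times> real) set"
  assumes E: "hausdorff_premeasure (1 + s) 1 E = 0" and s: "0 < s" and \<kappa>: "0 < \<kappa>"
  shows "\<exists>v\<in>{V..V + 1}. \<exists>W d. (\<forall>i. 0 < d i) \<and> {t. (t, v) \<in> E} \<subseteq> (\<Union>i. W i) \<and>
    (\<forall>i. \<forall>x\<in>W i. \<forall>y\<in>W i. dist x y \<le> d i) \<and>
    (\<Sum>i::nat. if W i = {} then 0 else ennreal (d i powr s)) \<le> ennreal \<kappa>"
proof -
  \<comment> \<open>One factor 2 is lost to the enlargement of the diameters, the other to the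
    interval length \<open>2 * d i\<close>.\<close>
  define \<epsilon> where "\<epsilon> = \<kappa> / 4"
  have \<epsilon>: "0 < \<epsilon>" using \<kappa> by (simp add: \<epsilon>_def)
  have "hausdorff_premeasure (1 + s) 1 E < ennreal \<epsilon>" using E \<epsilon> by simp
  then obtain U :: "nat \<Rightarrow> ('a \<times> real) set" where U: "E \<subseteq> (\<Union>i. U i)" "\<And>i. bounded (U i)"
    "(\<Sum>i. diam_powr (1 + s) (U i)) < ennreal \<epsilon>"
    unfolding hausdorff_premeasure_def Inf_less_iff by blast
  \<comment> \<open>The summable extra term keeps every \<open>d i\<close> positive, also for sets
    of diameter 0; \<open>d i\<close> is then chosen so that
    \<open>d i powr (1 + s) = h i\<close>.\<close>
  define h where "h i = diameter (U i) powr (1 + s) + \<epsilon> * (1/2) ^ Suc i" for i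
  define d where "d i = h i powr (1 / (1 + s))" for i
  have h: "0 < h i" for i using \<epsilon> unfolding h_def by (intro add_nonneg_pos) auto
  have d: "0 < d i" for i using h[of i] by (simp add: d_def)
  have dh: "d i powr (1 + s) = h i" for i using h[of i] s by (simp add: d_def powr_powr)
  have diam: "diameter (U i) \<le> d i" for i
  proof -
    have "diameter (U i) = (diameter (U i) powr (1 + s)) powr (1 / (1 + s))"
      using s diameter_ge_0[OF U(2)] by (simp add: powr_powr)
    also have "\<dots> \<le> d i" unfolding d_def h_def using s \<epsilon> by (intro powr_mono2) auto
    finally show ?thesis .
  qed
  have dist: "dist x y \<le> d i" if "x \<in> U i" "y \<in> U i" for i x y
    using diameter_bounded_bound[OF U(2) that] diam[of i] by simp
  have sum_h: "(\<Sum>i. ennreal (h i)) < ennreal (2 * \<epsilon>)"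
  proof -
    have "(\<Sum>i. ennreal (h i)) = (\<Sum>i. diam_powr (1 + s) (U i) + ennreal (\<epsilon> * (1/2) ^ Suc i))"
      using s \<epsilon> by (intro suminf_cong) (auto simp: h_def diam_powr_def)
    also have "\<dots> = (\<Sum>i. diam_powr (1 + s) (U i)) + (\<Sum>i. ennreal (\<epsilon> * (1/2) ^ Suc i))"
      by (rule suminf_add[symmetric]) auto
    also have "(\<Sum>i. ennreal (\<epsilon> * (1/2) ^ Suc i)) = ennreal (\<epsilon> * 1)"
      using \<epsilon> by (intro suminf_ennreal_eq sums_mult power_half_series) auto
    also have "(\<Sum>i. diam_powr (1 + s) (U i)) + ennreal (\<epsilon> * 1) < ennreal \<epsilon> + ennreal (\<epsilon> * 1)"
      using U(3) by (subst (1 2) add.commute) (simp add: ennreal_add_left_cancel_less)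
    also have "\<dots> = ennreal (2 * \<epsilon>)" using \<epsilon> by (simp flip: ennreal_plus)
    finally show ?thesis .
  qed
  define p where "p i = snd (SOME z. z \<in> U i)" for i
  \<comment> \<open>An interval around the velocity of a chosen point replaces the projection of
    \<open>U i\<close>, which need not be measurable.\<close>
  define P where "P i = (if U i = {} then {} else {p i - d i..p i + d i})" for i
  have P: "v \<in> P i" if "(t, v) \<in> U i" for t v i
  proof -
    have "(SOME z. z \<in> U i) \<in> U i" using that by (rule someI)
    then have "dist v (p i) \<le> d i"
      using dist[OF that] dist_snd_le[of "(t, v)" "SOME z. z \<in> U i"] unfolding p_def
      by (metis order_trans snd_conv)
    then show ?thesis using that by (auto simp: P_def dist_real_def abs_le_iff)
  qed
  define g where "g v = (\<Sum>i. ennreal (d i powr s) * indicator (P i) v)" for v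
  have Pm[measurable]: "P i \<in> sets lborel" for i by (simp add: P_def)
  have "(\<integral>\<^sup>+ v. g v \<partial>lborel) = (\<Sum>i. \<integral>\<^sup>+ v. ennreal (d i powr s) * indicator (P i) v \<partial>lborel)"
    unfolding g_def by (intro nn_integral_suminf) measurable
  also have "\<dots> = (\<Sum>i. ennreal (d i powr s) * emeasure lborel (P i))"
    by (intro suminf_cong nn_integral_cmult_indicator Pm)
  also have "\<dots> \<le> (\<Sum>i. 2 * ennreal (h i))"
  proof (intro suminf_le)
    fix i
    have "emeasure lborel (P i) \<le> ennreal (2 * d i)" using d[of i] by (simp add: P_def)
    then have "ennreal (d i powr s) * emeasure lborel (P i) \<le> ennreal (d i powr s) * ennreal (2 * d i)"
      by (rule mult_left_mono) simp
    also have "\<dots> = 2 * ennreal (h i)"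
      using d[of i] dh[of i, symmetric] by (simp add: powr_add mult_ac flip: ennreal_mult ennreal_numeral)
    finally show "ennreal (d i powr s) * emeasure lborel (P i) \<le> 2 * ennreal (h i)" .
  qed auto
  also have "\<dots> = 2 * (\<Sum>i. ennreal (h i))" by simp
  also have "\<dots> < 2 * ennreal (2 * \<epsilon>)" using sum_h by (intro ennreal_mult_strict_left_mono) auto
  also have "\<dots> = ennreal \<kappa>"
    using \<kappa> by (simp add: \<epsilon>_def flip: ennreal_mult ennreal_numeral)
  finally have int: "(\<integral>\<^sup>+ v. g v \<partial>lborel) < ennreal \<kappa>" .
  have "\<exists>v\<in>{V..V + 1}. g v \<le> ennreal \<kappa>"
  proof (rule ccontr)
    assume "\<not> ?thesis"
    then have "ennreal \<kappa> * indicator {V..V + 1} v \<le> g v" for v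
      by (auto simp: indicator_def not_le less_imp_le)
    then have "(\<integral>\<^sup>+ v. ennreal \<kappa> * indicator {V..V + 1} v \<partial>lborel) \<le> (\<integral>\<^sup>+ v. g v \<partial>lborel)"
      by (intro nn_integral_mono)
    then show False using int by (simp add: nn_integral_cmult_indicator)
  qed
  then obtain v where v: "v \<in> {V..V + 1}" "g v \<le> ennreal \<kappa>" by blast
  define W where "W i = {t. (t, v) \<in> U i}" for i
  have "(\<Sum>i. if W i = {} then 0 else ennreal (d i powr s)) \<le> g v"
    unfolding g_def using P by (intro suminf_le) (auto simp: W_def indicator_def)
  then have "(\<Sum>i. if W i = {} then 0 else ennreal (d i powr s)) \<le> ennreal \<kappa>"
    using v(2) by (rule order_trans)
  moreover have "{t. (t, v) \<in> E} \<subseteq> (\<Union>i. W i)" using U(1) by (auto simp: W_def)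
  moreover have "dist x y \<le> d i" if "x \<in> W i" "y \<in> W i" for i x y
    using dist[of "(x, v)" i "(y, v)"] that by (simp add: W_def dist_Pair_Pair)
  ultimately show ?thesis using v(1) d by blast
qed

section \<open>Lower bound for the escaping set\<close>

context wall
begin

text \<open>Premeasure 0 would provide a velocity whose slice of the escaping set has a cheap cover,
  while \<open>escaping_point_outside\<close> finds an escaping time that this cover misses.\<close>

lemma escaping_premeasure_nonzero:
  fixes B s :: real
  assumes s: "0 < s" "s < 1"
  shows "hausdorff_premeasure (1 + s) 1 (escaping_set
    (static_wall_map (\<lambda>v. C * v powr \<gamma>) (\<lambda>t. B + A / (2 * pi) * sin (2 * pi * t)))) \<noteq> 0"
    (is "hausdorff_premeasure _ _ ?E \<noteq> 0")
proof
  assume zero: "hausdorff_premeasure (1 + s) 1 ?E = 0"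
  obtain V where V: "large s V" using ex_large[OF s] by blast
  then have V0: "0 < V" by (simp add: large_def)
  \<comment> \<open>The velocity \<open>v\<close> is found only after \<kappa> is fixed, so the
    threshold is taken at \<open>V + 1\<close>, where it is least because \<open>expand_hi\<close>
    is increasing.\<close>
  define \<kappa> where "\<kappa> = (1 / (2 * expand_hi (V + 1 + A))) powr s"
  have "0 < \<kappa>" using expand_hi_ge_1[of "V + 1 + A"] by (simp add: \<kappa>_def)
  from slice_cover[OF zero s(1) this, of V]
  obtain v W d where v: "v \<in> {V..V + 1}" and d: "\<And>i. 0 < d i"
    and cover: "{t. (t, v) \<in> ?E} \<subseteq> (\<Union>i. W i)"
    and dist: "\<And>i x y. x \<in> W i \<Longrightarrow> y \<in> W i \<Longrightarrow> dist x y \<le> d i"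
    and sum: "(\<Sum>i::nat. if W i = {} then 0 else ennreal (d i powr s)) \<le> ennreal \<kappa>"
    by blast
  define J where "J = {- C * v powr \<gamma> - 1/6 .. - C * v powr \<gamma> - 1/12}"
  define U where "U i = {x \<in> J. circle_of x \<in> W i}" for i
  have "\<exists>x\<in>J. (\<forall>i. x \<notin> U i) \<and> (\<forall>n. v + n * A \<le> lift_vel n v x)"
  proof (rule escaping_point_outside[of s V v U d, OF V _ s(1) _ d, folded J_def])
    show "V \<le> v" using v by simp
    show "\<bar>x - y\<bar> \<le> d i" if "x \<in> U i" "y \<in> U i" for i x y
    proof -
      have "\<bar>x - y\<bar> \<le> 1 / 2" using that unfolding U_def J_def mem_Collect_eq atLeastAtMost_iff by linarith
      then show ?thesis using that dist[of "circle_of x" i "circle_of y"]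
        by (simp add: U_def dist_circle_of)
    qed
    have "hitting_mass s U d J \<le> (\<Sum>i. if W i = {} then 0 else ennreal (d i powr s))"
      unfolding hitting_mass_def by (intro suminf_le) (auto simp: U_def)
    also note sum
    also have "ennreal \<kappa> \<le> ennreal ((1 / (2 * expand_hi (v + A))) powr s)"
    proof -
      have le: "2 * expand_hi (v + A) \<le> 2 * expand_hi (V + 1 + A)"
        using v V0 A expand_hi_mono[of "v + A" "V + 1 + A"] by simp
      have "1 \<le> expand_hi (v + A)" "1 \<le> expand_hi (V + 1 + A)" by (rule expand_hi_ge_1)+
      then show ?thesis
        unfolding \<kappa>_def using s le
        by (intro ennreal_leI powr_mono2 divide_left_mono mult_pos_pos) auto
    qed
    finally show "hitting_mass s U d J \<le> ennreal ((1 / (2 * expand_hi (v + A))) powr s)" .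
  qed
  then obtain x where x: "x \<in> J" "\<And>i. x \<notin> U i" "\<And>n. v + real n * A \<le> lift_vel n v x" by blast
  have "(circle_of x, v) \<in> ?E" using x(3) v V0 by (intro escaping_setI) auto
  then obtain i where "circle_of x \<in> W i" using cover by blast
  then show False using x(1,2) by (auto simp: U_def)
qed

end

section \<open>The two bounds for the Hausdorff dimension\<close>

theorem theoremA:
  fixes \<alpha> \<gamma> A B C :: real
    and \<phi> T :: "real \<Rightarrow> real"
    and F :: "circle \<times> real \<Rightarrow> circle \<times> real"
    and E :: "(circle \<times> real) set"
  assumes "0 < \<alpha>" and "\<alpha> < 1"
    and "\<gamma> = 2 / \<alpha> - 1"
    and "C > 0"
    and "A > 0" and "B > A / (2 * pi)"
    and "\<phi> = (\<lambda>t. B + A / (2 * pi) * sin (2 * pi * t))"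
    and "T = (\<lambda>v. C * v powr \<gamma>)"
    and "F = static_wall_map T \<phi>"
    and "E = escaping_set F"
  shows "hausdorff_dim E = 2"
proof (rule antisym)
  have "2 < 2 / \<alpha>" using assms(1,2) by (simp add: field_simps)
  then have "1 < \<gamma>" using assms(3) by simp
  then interpret wall A C \<gamma> using assms by unfold_locales auto
  have E: "E = escaping_set
    (static_wall_map (\<lambda>v. C * v powr \<gamma>) (\<lambda>t. B + A / (2 * pi) * sin (2 * pi * t)))"
    using assms by simp
  show "hausdorff_dim E \<le> 2"
  proof (rule ennreal_le_epsilon)
    fix e :: real assume e: "0 < e"
    have "0 < snd p" if "p \<in> E" for p
      using that unfolding assms(10) escaping_set_def mem_Collect_eq by (metis funpow_0)
    then have "hausdorff_measure (2 + e) E = 0"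
      using e by (intro hausdorff_measure_upper_half) auto
    then have "hausdorff_dim E \<le> ennreal (2 + e)"
      unfolding hausdorff_dim_def using e by (intro Inf_lower CollectI exI[of _ "2 + e"]) simp
    also have "ennreal (2 + e) = 2 + ennreal e" using e by simp
    finally show "hausdorff_dim E \<le> 2 + ennreal e" .
  qed
  show "2 \<le> hausdorff_dim E"
    unfolding hausdorff_dim_def
  proof (rule Inf_greatest, safe)
    fix r :: real assume r: "0 \<le> r" "hausdorff_measure r E = 0"
    have "2 \<le> r"
    proof (rule ccontr)
      assume "\<not> 2 \<le> r"
      \<comment> \<open>The maximum with 1/2 keeps \<open>s\<close> in (0, 1) also for
        \<open>r \<le> 1\<close>; an exponent \<open>r < 2\<close> is thus raised to some
        \<open>1 + s < 2\<close>.\<close>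
      define s where "s = max (1/2) (r - 1)"
      have s: "0 < s" "s < 1" "r \<le> 1 + s" using \<open>\<not> 2 \<le> r\<close> by (auto simp: s_def)
      have "hausdorff_premeasure (1 + s) 1 E \<le> hausdorff_premeasure r 1 E"
        using r s by (intro hausdorff_premeasure_mono_exponent) auto
      also have "\<dots> \<le> hausdorff_measure r E"
        unfolding hausdorff_measure_def by (rule SUP_upper) simp
      finally have "hausdorff_premeasure (1 + s) 1 E = 0" using r(2) by simp
      then show False using escaping_premeasure_nonzero[OF s(1,2), of B] E by simp
    qed
    then show "2 \<le> ennreal r" by (simp add: ennreal_leI flip: ennreal_numeral)
  qed
qed

end
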